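(* $\mathcal{D}=\mathcal{J}$ in the semigroup $\mathcal{PO}_{\infty}(\mathbb{N}^3_{\leqslant})$, where $\mathcal{D}$ and $\mathcal{J}$ are Green's relations on $\mathcal{PO}_{\infty}(\mathbb{N}^3_{\leqslant})$.
   Context: $\mathbb{N}$ is the set of positive integers, and $\mathbb{N}^3_{\leqslant}$ is the set $\mathbb{N}^3$ with the product order: $(i_1,i_2,i_3)\leqslant(j_1,j_2,j_3)$ iff $i_k\le j_k$ for all $k$. A partial map $\alpha$ of a poset is monotone if $x\leqslant y$ implies $(x)\alpha\leqslant(y)\alpha$ for all $x,y\in\operatorname{dom}\alpha$. Maps are written on the right, and partial maps are composed by $(x)(\alpha\beta)=((x)\alpha)\beta$ with $\operatorname{dom}(\alpha\beta)=\{y\in\operatorname{dom}\alpha: (y)\alpha\in\operatorname{dom}\beta\}$. $\mathcal{PO}_{\infty}(\mathbb{N}^3_{\leqslant})$ is the semigroup, under this composition, of all injective monotone partial selfmaps $\alpha$ of $\mathbb{N}^3_{\leqslant}$ such that $\mathbb{N}^3\setminus\operatorname{dom}\alpha$ and $\mathbb{N}^3\setminus\operatorname{ran}\alpha$ are finite. Green's relations on a semigroup $S$: $a\mathcal{R}b$ iff $aS^1=bS^1$; $a\mathcal{L}b$ iff $S^1a=S^1b$; $a\mathcal{J}b$ iff $S^1aS^1=S^1bS^1$; $\mathcal{D}=\mathcal{L}\circ\mathcal{R}=\mathcal{R}\circ\mathcal{L}$. *)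

theory Defs
  imports Main "HOL-Library.Product_Order"
begin

section \<open>Green's relations\<close>

text \<open>A semigroup is given by a carrier \<open>S\<close> and a multiplication \<open>m\<close>. Since the
  monoid \<open>S\<^sup>1\<close> is \<open>S\<close> with an identity adjoined if there is none, \<open>a S\<^sup>1 = {a} \<union> a S\<close>,
  \<open>S\<^sup>1 a = {a} \<union> S a\<close> and \<open>S\<^sup>1 a S\<^sup>1 = {a} \<union> a S \<union> S a \<union> S a S\<close>.\<close>

locale semigroup_on =
  fixes S :: "'a set" and m :: "'a \<Rightarrow> 'a \<Rightarrow> 'a"
  assumes closed: "a \<in> S \<Longrightarrow> b \<in> S \<Longrightarrow> m a b \<in> S"
    and assoc: "a \<in> S \<Longrightarrow> b \<in> S \<Longrightarrow> c \<in> S \<Longrightarrow> m (m a b) c = m a (m b c)"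

definition right_ideal1 :: "'a set \<Rightarrow> ('a \<Rightarrow> 'a \<Rightarrow> 'a) \<Rightarrow> 'a \<Rightarrow> 'a set" where
  "right_ideal1 S m a = {a} \<union> {m a s | s. s \<in> S}"

definition left_ideal1 :: "'a set \<Rightarrow> ('a \<Rightarrow> 'a \<Rightarrow> 'a) \<Rightarrow> 'a \<Rightarrow> 'a set" where
  "left_ideal1 S m a = {a} \<union> {m s a | s. s \<in> S}"

definition ideal1 :: "'a set \<Rightarrow> ('a \<Rightarrow> 'a \<Rightarrow> 'a) \<Rightarrow> 'a \<Rightarrow> 'a set" where
  "ideal1 S m a =
     {a} \<union> {m a t | t. t \<in> S} \<union> {m s a | s. s \<in> S} \<union> {m (m s a) t | s t. s \<in> S \<and> t \<in> S}"

definition green_R :: "'a set \<Rightarrow> ('a \<Rightarrow> 'a \<Rightarrow> 'a) \<Rightarrow> 'a rel" where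
  "green_R S m = {(a, b). a \<in> S \<and> b \<in> S \<and> right_ideal1 S m a = right_ideal1 S m b}"

definition green_L :: "'a set \<Rightarrow> ('a \<Rightarrow> 'a \<Rightarrow> 'a) \<Rightarrow> 'a rel" where
  "green_L S m = {(a, b). a \<in> S \<and> b \<in> S \<and> left_ideal1 S m a = left_ideal1 S m b}"

definition green_J :: "'a set \<Rightarrow> ('a \<Rightarrow> 'a \<Rightarrow> 'a) \<Rightarrow> 'a rel" where
  "green_J S m = {(a, b). a \<in> S \<and> b \<in> S \<and> ideal1 S m a = ideal1 S m b}"

text \<open>In a semigroup the two relations commute, so the order of composition does not
  matter; see \<open>green_L_R_commute\<close> below.\<close>

definition green_D :: "'a set \<Rightarrow> ('a \<Rightarrow> 'a \<Rightarrow> 'a) \<Rightarrow> 'a rel" where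
  "green_D S m = green_L S m O green_R S m"

context semigroup_on
begin

lemma green_L_iff:
  "(a, b) \<in> green_L S m \<longleftrightarrow> a \<in> S \<and> b \<in> S \<and>
     (a = b \<or> (\<exists>s\<in>S. a = m s b)) \<and> (a = b \<or> (\<exists>s\<in>S. b = m s a))"
proof -
  have sub: "left_ideal1 S m x \<subseteq> left_ideal1 S m y"
    if "x \<in> S" "y \<in> S" "x = y \<or> (\<exists>s\<in>S. x = m s y)" for x y
  proof (cases "x = y")
    case False
    with that(3) obtain s where s: "s \<in> S" "x = m s y" by blast
    have "m u x \<in> left_ideal1 S m y" if "u \<in> S" for u
    proof -
      have "m u x = m (m u s) y" using s that \<open>y \<in> S\<close> by (simp add: assoc)
      then show ?thesis using closed[OF that s(1)] unfolding left_ideal1_def by blast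
    qed
    moreover have "x \<in> left_ideal1 S m y" using s unfolding left_ideal1_def by blast
    ultimately show ?thesis by (auto simp: left_ideal1_def[of _ _ x])
  qed simp
  show ?thesis
  proof
    assume "(a, b) \<in> green_L S m"
    then have "a \<in> S" "b \<in> S" "left_ideal1 S m a = left_ideal1 S m b"
      by (auto simp: green_L_def)
    moreover have "a \<in> left_ideal1 S m a" "b \<in> left_ideal1 S m b"
      by (auto simp: left_ideal1_def)
    ultimately have "a \<in> left_ideal1 S m b" "b \<in> left_ideal1 S m a" by auto
    with \<open>a \<in> S\<close> \<open>b \<in> S\<close> show "a \<in> S \<and> b \<in> S \<and>
     (a = b \<or> (\<exists>s\<in>S. a = m s b)) \<and> (a = b \<or> (\<exists>s\<in>S. b = m s a))"
      by (auto simp: left_ideal1_def)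
  next
    assume "a \<in> S \<and> b \<in> S \<and>
     (a = b \<or> (\<exists>s\<in>S. a = m s b)) \<and> (a = b \<or> (\<exists>s\<in>S. b = m s a))"
    then have S: "a \<in> S" "b \<in> S" and 1: "a = b \<or> (\<exists>s\<in>S. a = m s b)"
      and 2: "b = a \<or> (\<exists>s\<in>S. b = m s a)" by metis+
    from sub[OF S 1] sub[OF S(2,1) 2] S show "(a, b) \<in> green_L S m"
      unfolding green_L_def by blast
  qed
qed

lemma green_R_iff:
  "(a, b) \<in> green_R S m \<longleftrightarrow> a \<in> S \<and> b \<in> S \<and>
     (a = b \<or> (\<exists>s\<in>S. a = m b s)) \<and> (a = b \<or> (\<exists>s\<in>S. b = m a s))"
proof -
  interpret op: semigroup_on S "\<lambda>x y. m y x"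
    by unfold_locales (auto simp: closed assoc)
  have "green_R S m = green_L S (\<lambda>x y. m y x)"
    by (simp add: green_R_def green_L_def right_ideal1_def left_ideal1_def)
  then show ?thesis using op.green_L_iff by simp
qed

lemma green_L_R_commute: "green_L S m O green_R S m = green_R S m O green_L S m"
proof -
  have "\<exists>d. (a, d) \<in> green_R S m \<and> (d, b) \<in> green_L S m"
    if "(a, c) \<in> green_L S m" "(c, b) \<in> green_R S m" for a b c
  proof -
    have S: "a \<in> S" "b \<in> S" "c \<in> S" using that unfolding green_L_def green_R_def by blast+
    show ?thesis
    proof (cases "a = c \<or> c = b")
      case True
      then show ?thesis
        using that S by (auto simp: green_L_def green_R_def)
    next
      case False
      then have "\<exists>s\<in>S. a = m s c" "\<exists>s\<in>S. c = m s a" "\<exists>t\<in>S. c = m b t" "\<exists>t\<in>S. b = m c t"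
        using that green_L_iff[of a c] green_R_iff[of c b] by metis+
      then obtain s s' t t' where *: "s \<in> S" "s' \<in> S" "t \<in> S" "t' \<in> S"
        "a = m s c" "c = m s' a" "c = m b t" "b = m c t'"
        by (elim bexE) (rule that)
      have "m s b = m s (m c t')" using *(8) by (rule arg_cong)
      also have "\<dots> = m (m s c) t'" using assoc[OF *(1) S(3) *(4)] by (rule sym)
      finally have 1: "m s b = m a t'" using *(5) by metis
      have "a = m s (m b t)" using *(5,7) by metis
      then have 2: "a = m (m s b) t" using assoc[OF *(1) S(2) *(3)] by metis
      have "b = m (m s' a) t'" using *(6,8) by metis
      then have "b = m s' (m a t')" using assoc[OF *(2) S(1) *(4)] by metis
      then have 3: "b = m s' (m s b)" using 1 by metis
      have "m s b \<in> S" using closed[OF *(1) S(2)] .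
      then have "(a, m s b) \<in> green_R S m" 
        unfolding green_R_iff using S(1) \<open>m s b \<in> S\<close> *(3,4) 1 2 by metis
      moreover have "(m s b, b) \<in> green_L S m"
        unfolding green_L_iff 
        using \<open>m s b \<in> S\<close> S(2) *(1,2) 3 by metis
      ultimately show ?thesis by blast
    qed
  qed
  moreover have "\<exists>d. (a, d) \<in> green_L S m \<and> (d, b) \<in> green_R S m"
    if "(a, c) \<in> green_R S m" "(c, b) \<in> green_L S m" for a b c
  proof -
    have "(b, c) \<in> green_L S m" "(c, a) \<in> green_R S m"
      using that by (auto simp: green_L_def green_R_def)
    with calculation obtain d where "(b, d) \<in> green_R S m" "(d, a) \<in> green_L S m" by blast
    then have "(a, d) \<in> green_L S m \<and> (d, b) \<in> green_R S m"
      by (auto simp: green_L_def green_R_def)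
    then show ?thesis by blast
  qed
  ultimately show ?thesis by blast
qed

end

section \<open>The semigroup of cofinite injective monotone partial selfmaps\<close>

text \<open>The positive octant; the theory \<open>Product_Order\<close> makes \<open>\<le>\<close> on triples the
  componentwise order.\<close>

definition N3 :: "(nat \<times> nat \<times> nat) set" where
  "N3 = {1..} \<times> {1..} \<times> {1..}"

text \<open>Maps act on the right, so in \<open>pmult \<alpha> \<beta>\<close> the map \<open>\<alpha>\<close> is applied first.\<close>

definition pmult :: "('a \<rightharpoonup> 'a) \<Rightarrow> ('a \<rightharpoonup> 'a) \<Rightarrow> ('a \<rightharpoonup> 'a)" where
  "pmult \<alpha> \<beta> = \<beta> \<circ>\<^sub>m \<alpha>"

definition PO_infty :: "((nat \<times> nat \<times> nat) \<rightharpoonup> (nat \<times> nat \<times> nat)) set" where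
  "PO_infty = {\<alpha>. dom \<alpha> \<subseteq> N3 \<and> ran \<alpha> \<subseteq> N3 \<and>
     inj_on \<alpha> (dom \<alpha>) \<and>
     (\<forall>x\<in>dom \<alpha>. \<forall>y\<in>dom \<alpha>. x \<le> y \<longrightarrow> the (\<alpha> x) \<le> the (\<alpha> y)) \<and>
     finite (N3 - dom \<alpha>) \<and> finite (N3 - ran \<alpha>)}"

lemma le_triple_iff:
  "((i1, i2, i3) :: nat \<times> nat \<times> nat) \<le> (j1, j2, j3) \<longleftrightarrow> i1 \<le> j1 \<and> i2 \<le> j2 \<and> i3 \<le> j3"
  by simp

lemma dom_pmult: "dom (pmult \<alpha> \<beta>) = {y \<in> dom \<alpha>. the (\<alpha> y) \<in> dom \<beta>}"
  by (auto simp: pmult_def map_comp_def dom_def split: option.splits)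

lemma PO_infty_pmult_closed:
  assumes a: "\<alpha> \<in> PO_infty" and b: "\<beta> \<in> PO_infty"
  shows "pmult \<alpha> \<beta> \<in> PO_infty"
proof -
  have inj: "inj_on \<alpha> (dom \<alpha>)" "inj_on \<beta> (dom \<beta>)"
    and mono: "\<forall>x\<in>dom \<alpha>. \<forall>y\<in>dom \<alpha>. x \<le> y \<longrightarrow> the (\<alpha> x) \<le> the (\<alpha> y)"
      "\<forall>x\<in>dom \<beta>. \<forall>y\<in>dom \<beta>. x \<le> y \<longrightarrow> the (\<beta> x) \<le> the (\<beta> y)"
    using a b by (simp_all add: PO_infty_def)
  have inja: "x = y" if "\<alpha> x = Some u" "\<alpha> y = Some u" for x y u
    using inj_onD[OF inj(1), of x y] domI[of "\<alpha>", OF that(1)] domI[of "\<alpha>", OF that(2)] that by simp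
  have injb: "x = y" if "\<beta> x = Some u" "\<beta> y = Some u" for x y u
    using inj_onD[OF inj(2), of x y] domI[of "\<beta>", OF that(1)] domI[of "\<beta>", OF that(2)] that by simp
  have ma: "u \<le> v" if "\<alpha> x = Some u" "\<alpha> y = Some v" "x \<le> y" for x y u v
    using mono(1)[rule_format, OF domI[of "\<alpha>", OF that(1)] domI[of "\<alpha>", OF that(2)] that(3)] that by simp
  have mb: "u \<le> v" if "\<beta> x = Some u" "\<beta> y = Some v" "x \<le> y" for x y u v
    using mono(2)[rule_format, OF domI[of "\<beta>", OF that(1)] domI[of "\<beta>", OF that(2)] that(3)] that by simp
  have sub: "dom \<alpha> \<subseteq> N3" "ran \<alpha> \<subseteq> N3" "dom \<beta> \<subseteq> N3" "ran \<beta> \<subseteq> N3"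
    and fin: "finite (N3 - dom \<alpha>)" "finite (N3 - ran \<alpha>)"
      "finite (N3 - dom \<beta>)" "finite (N3 - ran \<beta>)"
    using a b by (simp_all add: PO_infty_def)
  have ex: "pmult \<alpha> \<beta> x = Some z \<longleftrightarrow> (\<exists>y. \<alpha> x = Some y \<and> \<beta> y = Some z)" for x z
    by (auto simp: pmult_def map_comp_def split: option.splits)
  let ?A = "{x \<in> dom \<alpha>. the (\<alpha> x) \<notin> dom \<beta>}"
  have "finite ?A"
  proof (rule inj_on_finite)
    show "inj_on (the \<circ> \<alpha>) ?A"
    proof (rule inj_onI)
      fix x y assume "x \<in> ?A" "y \<in> ?A" and eq: "(the \<circ> \<alpha>) x = (the \<circ> \<alpha>) y"
      then obtain u v where "\<alpha> x = Some u" "\<alpha> y = Some v" by blast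
      with eq show "x = y" using inja[of x u y] by simp
    qed
    show "(the \<circ> \<alpha>) ` ?A \<subseteq> N3 - dom \<beta>"
    proof
      fix z assume "z \<in> (the \<circ> \<alpha>) ` ?A"
      then obtain x where x: "x \<in> dom \<alpha>" "z = the (\<alpha> x)" "z \<notin> dom \<beta>" by force
      then have "\<alpha> x = Some z" by (metis domD option.sel)
      then have "z \<in> N3" using sub(2) ranI[of \<alpha>] by blast
      with x show "z \<in> N3 - dom \<beta>" by blast
    qed
  qed (rule fin)
  moreover have "N3 - dom (pmult \<alpha> \<beta>) \<subseteq> (N3 - dom \<alpha>) \<union> ?A"
    unfolding dom_pmult by blast
  ultimately have fd: "finite (N3 - dom (pmult \<alpha> \<beta>))"
    using fin(1) by (meson finite_UnI finite_subset)
  have "N3 - ran (pmult \<alpha> \<beta>) \<subseteq> (N3 - ran \<beta>) \<union> (the \<circ> \<beta>) ` (N3 - ran \<alpha>)"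
  proof
    fix z assume z: "z \<in> N3 - ran (pmult \<alpha> \<beta>)"
    show "z \<in> (N3 - ran \<beta>) \<union> (the \<circ> \<beta>) ` (N3 - ran \<alpha>)"
    proof (cases "z \<in> ran \<beta>")
      case True
      then obtain y where y: "\<beta> y = Some z" unfolding ran_def by blast
      have "y \<notin> ran \<alpha>"
      proof
        assume "y \<in> ran \<alpha>"
        then obtain x where "\<alpha> x = Some y" unfolding ran_def by blast
        with y ex have "pmult \<alpha> \<beta> x = Some z" by blast
        with z show False using ranI[of "pmult \<alpha> \<beta>"] by blast
      qed
      moreover have "y \<in> N3" using sub(3) y domI[of \<beta>] by blast
      moreover have "z = (the \<circ> \<beta>) y" using y by simp
      ultimately show ?thesis by blast
    qed (use z in blast)
  qed
  then have fr: "finite (N3 - ran (pmult \<alpha> \<beta>))"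
    using fin(2,4) by (meson finite_UnI finite_imageI finite_subset)
  have "inj_on (pmult \<alpha> \<beta>) (dom (pmult \<alpha> \<beta>))"
  proof (rule inj_onI)
    fix x y assume "x \<in> dom (pmult \<alpha> \<beta>)" and eq: "pmult \<alpha> \<beta> x = pmult \<alpha> \<beta> y"
    then obtain z where z: "pmult \<alpha> \<beta> x = Some z" by blast
    then obtain u v where "\<alpha> x = Some u" "\<beta> u = Some z" "\<alpha> y = Some v" "\<beta> v = Some z"
      using eq ex by metis
    then show "x = y" using inja[of x u y] injb[of u z v] by simp
  qed
  moreover have "the (pmult \<alpha> \<beta> x) \<le> the (pmult \<alpha> \<beta> y)"
    if xy: "x \<in> dom (pmult \<alpha> \<beta>)" "y \<in> dom (pmult \<alpha> \<beta>)" "x \<le> y" for x y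
  proof -
    obtain u v where uv: "pmult \<alpha> \<beta> x = Some u" "pmult \<alpha> \<beta> y = Some v"
      using xy by blast
    then obtain u' v' where "\<alpha> x = Some u'" "\<beta> u' = Some u" "\<alpha> y = Some v'" "\<beta> v' = Some v"
      using ex by blast
    then have "u \<le> v" using ma[OF _ _ xy(3)] mb by blast
    with uv show ?thesis by simp
  qed
  moreover have "dom (pmult \<alpha> \<beta>) \<subseteq> N3" using sub(1) unfolding dom_pmult by blast
  moreover have "ran (pmult \<alpha> \<beta>) \<subseteq> N3"
  proof
    fix z assume "z \<in> ran (pmult \<alpha> \<beta>)"
    then obtain y where "\<beta> y = Some z" using ex unfolding ran_def by blast
    then show "z \<in> N3" using sub(4) ranI[of \<beta>] by blast
  qed
  ultimately show ?thesis using fd fr unfolding PO_infty_def by blast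
qed

interpretation PO_infty: semigroup_on PO_infty pmult
proof
  show "pmult a b \<in> PO_infty" if "a \<in> PO_infty" "b \<in> PO_infty" for a b
    using that by (rule PO_infty_pmult_closed)
  show "pmult (pmult a b) c = pmult a (pmult b c)" for a b c :: "(nat \<times> nat \<times> nat) \<rightharpoonup> _"
    by (auto simp: pmult_def map_comp_def fun_eq_iff split: option.splits)
qed

end

theory Submission
  imports Defs
begin

text \<open>
  The inclusion of \<open>\<D>\<close> in \<open>\<J>\<close> holds in every semigroup. For the converse, call the sum of the
  three coordinates of a point its height. Everything rests on one geometric fact
  (\<open>height_image_le\<close>): an injective monotone map between cofinite subsets of the octant never
  increases the height of a point.

  This fact fails in dimension one, where \<open>n \<mapsto> n + 1\<close> is such a map, so its proof has to use
  how the coordinate directions interact. The preimage of an axis is an infinite downward closed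
  set, hence contains almost all of some axis; in this way the map sends almost all of the axis
  \<open>\<sigma> i\<close> into the axis \<open>i\<close> for some permutation \<open>\<sigma>\<close> (\<open>axis_permutation\<close>). Counting along the axes,
  coordinate \<open>\<sigma> i\<close> of \<open>z\<close> exceeds coordinate \<open>i\<close> of the image of \<open>z\<close> by at most a constant
  (\<open>coord_le_coord_image_plus\<close>). The opposite comparison needs no constant (\<open>coord_image_le\<close>):
  if coordinate \<open>i\<close> of the image of \<open>x\<close> exceeded \<open>k\<close>, the coordinate \<open>\<sigma> i\<close> of \<open>x\<close>, then the
  preimage of the slab of thickness \<open>k\<close> along a coordinate plane would avoid everything above
  \<open>x\<close>, and so would lie in the union of a slab of thickness \<open>k - 1\<close> and finitely many lines. The points of
  height \<open>N\<close> in the first slab form an antichain with about \<open>k N\<close> elements. Preimages of antichains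
  under monotone maps are antichains, and the thinner slab and the lines leave room only for about
  \<open>(k - 1) N\<close> elements, a contradiction for large \<open>N\<close>.

  Only finitely many points have a height below a given bound. Two monotone injections
  \<open>P \<rightarrow> Q\<close> and \<open>Q \<rightarrow> P\<close> that do not increase heights therefore restrict to bijections between
  these finite parts, and likewise between the comparable pairs in them, which makes both of them
  order isomorphisms (\<open>mutual_height_decreasing_iso\<close>).

  Now let \<open>\<alpha> \<J> \<beta>\<close>, that is, \<open>\<alpha> = \<gamma> \<beta> \<delta>\<close> and \<open>\<beta> = \<gamma>' \<alpha> \<delta>'\<close>. Then \<open>\<gamma>\<close> and \<open>\<gamma>'\<close> map the domains
  of \<open>\<alpha>\<close> and \<open>\<beta>\<close> into each other, so they are isomorphisms between them, and then \<open>\<delta>\<close> and \<open>\<delta>'\<close> do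
  the same for the ranges. Hence \<open>\<gamma>\<close> and \<open>\<delta>\<close> can be inverted where it matters, and the element
  \<open>\<gamma> \<beta>\<close> is \<open>\<L>\<close>-related to \<open>\<beta>\<close> and \<open>\<R>\<close>-related to \<open>\<alpha>\<close>.
\<close>

section \<open>Coordinates in the octant\<close>

text \<open>Naming the three directions by a type lets one argument treat all of them at once and
  makes their permutations ordinary bijections.\<close>


datatype axis = Ax1 | Ax2 | Ax3

fun coord :: "axis \<Rightarrow> nat \<times> nat \<times> nat \<Rightarrow> nat" where
  "coord Ax1 (a, b, c) = a"
| "coord Ax2 (a, b, c) = b"
| "coord Ax3 (a, b, c) = c"

text \<open>The first number goes to the given direction, the other two fill the remaining
  directions in increasing order; so \<open>point i n 1 1\<close> runs along the axis \<open>i\<close>.\<close>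

fun point :: "axis \<Rightarrow> nat \<Rightarrow> nat \<Rightarrow> nat \<Rightarrow> nat \<times> nat \<times> nat" where
  "point Ax1 a b c = (a, b, c)"
| "point Ax2 a b c = (b, a, c)"
| "point Ax3 a b c = (b, c, a)"

definition height :: "nat \<times> nat \<times> nat \<Rightarrow> nat" where
  "height x = coord Ax1 x + coord Ax2 x + coord Ax3 x"

definition on_axis :: "axis \<Rightarrow> nat \<times> nat \<times> nat \<Rightarrow> bool" where
  "on_axis i y \<longleftrightarrow> y \<in> N3 \<and> (\<forall>j. j \<noteq> i \<longrightarrow> coord j y = 1)"

lemma UNIV_axis: "(UNIV :: axis set) = {Ax1, Ax2, Ax3}"
  using axis.exhaust by auto

lemma all_axis: "(\<forall>i. P i) \<longleftrightarrow> P Ax1 \<and> P Ax2 \<and> P Ax3"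
  by (metis axis.exhaust)

lemma le_iff_coord: "x \<le> y \<longleftrightarrow> (\<forall>i. coord i x \<le> coord i y)"
  by (cases x; cases y) (simp add: all_axis)

lemma eq_iff_coord: "x = y \<longleftrightarrow> (\<forall>i. coord i x = coord i y)"
  by (cases x; cases y) (simp add: all_axis)

lemma N3_iff_coord: "x \<in> N3 \<longleftrightarrow> (\<forall>i. 1 \<le> coord i x)"
  by (cases x) (simp add: all_axis N3_def)

lemma height_eq_sum: "height x = (\<Sum>i\<in>UNIV. coord i x)"
  by (simp add: UNIV_axis height_def)

lemma coord_le_height: "coord i x \<le> height x"
  by (cases i) (simp_all add: height_def)

text \<open>Points of equal height form an antichain.\<close>

lemma le_same_height_eq:
  assumes "x \<le> y" "height y \<le> height x"
  shows "x = y"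
  using assms by (cases x; cases y) (auto simp: height_def)

lemma finite_height_le: "finite {x. height x \<le> n}"
proof (rule finite_subset)
  show "{x. height x \<le> n} \<subseteq> {..n} \<times> {..n} \<times> {..n}"
    by (auto simp: height_def)
qed simp

lemma coord_point_same [simp]: "coord i (point i a b c) = a"
  by (cases i) simp_all

lemma coord_point_const [simp]: "j \<noteq> i \<Longrightarrow> coord j (point i a b b) = b"
  by (cases i; cases j) simp_all

lemma height_point [simp]: "height (point i a b c) = a + b + c"
  by (cases i) (simp_all add: height_def)

lemma point_in_N3 [simp]: "point i a b c \<in> N3 \<longleftrightarrow> 1 \<le> a \<and> 1 \<le> b \<and> 1 \<le> c"
  by (cases i) (auto simp: N3_def)

lemma point_eq_iff [simp]: "point i a b c = point i a' b' c' \<longleftrightarrow> a = a' \<and> b = b' \<and> c = c'"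
  by (cases i) auto

lemma point_axis_le: "n \<le> coord j z \<Longrightarrow> z \<in> N3 \<Longrightarrow> point j n 1 1 \<le> z"
  by (cases z; cases j) (auto simp: N3_def)

lemma on_axis_eq_point: "on_axis i y \<Longrightarrow> y = point i (coord i y) 1 1"
  unfolding eq_iff_coord on_axis_def by (metis coord_point_same coord_point_const)

lemma on_axis_point: "1 \<le> n \<Longrightarrow> on_axis i (point i n 1 1)"
  unfolding on_axis_def by simp

lemma on_axis_downward: "on_axis i y \<Longrightarrow> x \<le> y \<Longrightarrow> x \<in> N3 \<Longrightarrow> on_axis i x"
  unfolding on_axis_def le_iff_coord N3_iff_coord by (metis le_antisym)

lemma infinite_axis: "infinite {y. on_axis i y}"
proof
  assume "finite {y. on_axis i y}"
  moreover have "(\<lambda>n. point i n 1 1) ` {1..} \<subseteq> {y. on_axis i y}"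
    using on_axis_point by auto
  ultimately have "finite ((\<lambda>n. point i n 1 1) ` {1..})"
    by (rule finite_subset[rotated])
  moreover have "inj_on (\<lambda>n. point i n 1 1) {1..}"
    by (auto simp: inj_on_def)
  ultimately show False
    using finite_imageD infinite_Ici by blast
qed

lemma infinite_imp_coord_unbounded:
  assumes "infinite L"
  shows "\<exists>j. \<forall>n. \<exists>z\<in>L. n \<le> coord j z"
proof (rule ccontr)
  assume "\<not> ?thesis"
  then obtain b where b: "\<And>j z. z \<in> L \<Longrightarrow> coord j z < b j"
    by (metis linorder_not_le)
  have "L \<subseteq> {x. height x \<le> b Ax1 + b Ax2 + b Ax3}"
  proof
    fix z assume "z \<in> L"
    from b[OF this, of Ax1] b[OF this, of Ax2] b[OF this, of Ax3]
    show "z \<in> {x. height x \<le> b Ax1 + b Ax2 + b Ax3}"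
      by (simp add: height_def)
  qed
  with assms finite_height_le show False
    using finite_subset by blast
qed

text \<open>The two free parameters are coordinate \<open>i\<close>, from \<open>1\<close> to \<open>k\<close>, and a second coordinate, from
  \<open>1\<close> to \<open>t\<close>; the height \<open>k + t + 1\<close> leaves a third coordinate that is at least \<open>1\<close>.\<close>

lemma card_slab_antichain:
  "k * t \<le> card {y \<in> N3. coord i y \<le> k \<and> height y = k + t + 1}"
proof -
  let ?Y = "{y \<in> N3. coord i y \<le> k \<and> height y = k + t + 1}"
  let ?g = "\<lambda>(a, b). point i a b (k + t + 1 - a - b)"
  have "?g ` ({1..k} \<times> {1..t}) \<subseteq> ?Y"
    by auto
  moreover have "inj_on ?g ({1..k} \<times> {1..t})"
    by (auto simp: inj_on_def)
  moreover have "finite ?Y"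
    by (rule finite_subset[OF _ finite_height_le[of "k + t + 1"]]) auto
  ultimately have "card ({1..k} \<times> {1..t}) \<le> card ?Y"
    using card_inj_on_le by blast
  then show ?thesis by simp
qed

section \<open>Cofinite monotone injections do not increase the height\<close>

locale cofinite_mono_inj =
  fixes f :: "nat \<times> nat \<times> nat \<Rightarrow> nat \<times> nat \<times> nat" and A
  assumes dom_N3: "A \<subseteq> N3" and ran_N3: "f ` A \<subseteq> N3"
    and inj: "inj_on f A"
    and mono: "\<lbrakk>x \<in> A; y \<in> A; x \<le> y\<rbrakk> \<Longrightarrow> f x \<le> f y"
    and cofinite_dom: "finite (N3 - A)" and cofinite_ran: "finite (N3 - f ` A)"
begin

lemma comparable_same_height_eq:
  assumes "x \<in> A" "y \<in> A" "height (f x) = height (f y)" "x \<le> y \<or> y \<le> x"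
  shows "x = y"
  using assms mono le_same_height_eq inj by (metis inj_onD order_refl)

lemma axes_eventually_in_dom:
  obtains M where "\<And>j n. M < n \<Longrightarrow> point j n 1 1 \<in> A"
proof -
  have "finite (height ` (N3 - A))"
    using cofinite_dom by simp
  then obtain M where M: "\<And>z. z \<in> N3 - A \<Longrightarrow> height z \<le> M"
    unfolding finite_nat_set_iff_bounded_le by blast
  show thesis
  proof (rule that, rule ccontr)
    fix j n assume "M < n" and "point j n 1 1 \<notin> A"
    with M[of "point j n 1 1"] show False
      by simp
  qed
qed

text \<open>The points mapped into the axis \<open>i\<close> form an infinite downward closed subset of \<open>A\<close>. One of the
  coordinates is unbounded on it, and so it contains every point of \<open>A\<close> on the corresponding
  axis.\<close>

lemma ex_axis_mapped_into_axis:
  assumes M: "\<And>j n. M < n \<Longrightarrow> point j n 1 1 \<in> A"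
  shows "\<exists>j. \<forall>n>M. on_axis i (f (point j n 1 1))"
proof -
  let ?L = "{z \<in> A. on_axis i (f z)}"
  have "{y. on_axis i y} \<subseteq> f ` ?L \<union> (N3 - f ` A)"
    by (auto simp: on_axis_def)
  then have "infinite ?L"
    using infinite_axis[of i] cofinite_ran
    by (meson finite_UnI finite_imageI finite_subset)
  then obtain j where j: "\<And>n. \<exists>z\<in>?L. n \<le> coord j z"
    using infinite_imp_coord_unbounded by meson
  have "on_axis i (f (point j n 1 1))" if "M < n" for n
  proof -
    obtain z where z: "z \<in> A" "on_axis i (f z)" "n \<le> coord j z"
      using j by blast
    have "point j n 1 1 \<in> A"
      using M that .
    moreover have "point j n 1 1 \<le> z"
      using z dom_N3 by (intro point_axis_le) auto
    ultimately show ?thesis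
      using z mono ran_N3 on_axis_downward by (metis image_subset_iff)
  qed
  then show ?thesis by blast
qed

text \<open>Different axes meet only in \<open>(1, 1, 1)\<close>, so by injectivity no axis can be mapped into two
  of them.\<close>

lemma axis_permutation:
  assumes M: "\<And>j n. M < n \<Longrightarrow> point j n 1 1 \<in> A"
  shows "\<exists>\<sigma>. bij \<sigma> \<and> (\<forall>i. \<forall>n>M. on_axis i (f (point (\<sigma> i) n 1 1)))"
proof -
  obtain \<sigma> where \<sigma>: "\<And>i n. M < n \<Longrightarrow> on_axis i (f (point (\<sigma> i) n 1 1))"
    using ex_axis_mapped_into_axis[OF M] by metis
  have "inj \<sigma>"
  proof (rule injI, rule ccontr)
    fix i i' assume eq: "\<sigma> i = \<sigma> i'" and "i \<noteq> i'"
    have 1: "f (point (\<sigma> i) n 1 1) = (1, 1, 1)" if "M < n" for n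
    proof -
      have "coord l (f (point (\<sigma> i) n 1 1)) = 1" for l
        using \<sigma>[OF that, of i] \<sigma>[OF that, of i'] eq \<open>i \<noteq> i'\<close> unfolding on_axis_def by metis
      moreover have "coord l (1, 1, 1) = 1" for l
        by (cases l) simp_all
      ultimately show ?thesis
        unfolding eq_iff_coord by metis
    qed
    have "point (\<sigma> i) n 1 1 \<in> A" if "M < n" for n
      using M that .
    then have mem: "point (\<sigma> i) (M + 1) 1 1 \<in> A" "point (\<sigma> i) (M + 2) 1 1 \<in> A"
      by simp_all
    have "f (point (\<sigma> i) (M + 1) 1 1) = f (point (\<sigma> i) (M + 2) 1 1)"
      using 1[of "M + 1"] 1[of "M + 2"] by simp
    then have "point (\<sigma> i) (M + 1) 1 1 = point (\<sigma> i) (M + 2) 1 1"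
      using mem by (rule inj_onD[OF inj])
    then show False by simp
  qed
  moreover have "finite (UNIV :: axis set)"
    by (simp add: UNIV_axis)
  ultimately have "bij \<sigma>"
    using finite_UNIV_inj_surj by (auto simp: bij_def)
  with \<sigma> show ?thesis by blast
qed

text \<open>On the axis \<open>j\<close> the map climbs strictly along the axis \<open>i\<close>, at least one step for each point
  beyond \<open>M\<close>. A point \<open>z\<close> lies above the point of the axis \<open>j\<close> with the same coordinate \<open>j\<close>.\<close>

lemma coord_le_coord_image_plus:
  assumes M: "\<And>j n. M < n \<Longrightarrow> point j n 1 1 \<in> A"
    and ax: "\<forall>n>M. on_axis i (f (point j n 1 1))"
    and z: "z \<in> A"
  shows "coord j z \<le> coord i (f z) + M"
proof -
  let ?p = "\<lambda>n. point j n 1 1"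
  have inA: "?p n \<in> A" if "M < n" for n
    using M that .
  have step: "t \<le> coord i (f (?p (M + t)))" if "0 < t" for t
    using that
  proof (induction t)
    case (Suc t)
    show ?case
    proof (cases "t = 0")
      case True
      have "f (?p (M + 1)) \<in> N3"
        using ax by (simp add: on_axis_def)
      with True show ?thesis
        by (auto simp: N3_iff_coord)
    next
      case False
      let ?u = "f (?p (M + t))" and ?v = "f (?p (M + Suc t))"
      have mem: "?p (M + t) \<in> A" "?p (M + Suc t) \<in> A"
        using inA False by auto
      have le: "?u \<le> ?v"
        using mem by (intro mono point_axis_le) auto
      have ne: "?u \<noteq> ?v"
        using inj_onD[OF inj _ mem] by auto
      have "?u = point i (coord i ?u) 1 1" "?v = point i (coord i ?v) 1 1"
        using ax False by (auto intro!: on_axis_eq_point simp del: One_nat_def)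
      then have "coord i ?u \<noteq> coord i ?v"
        using ne by metis
      moreover have "coord i ?u \<le> coord i ?v"
        using le by (simp add: le_iff_coord)
      ultimately show ?thesis
        using Suc False by simp
    qed
  qed simp
  show ?thesis
  proof (cases "coord j z \<le> M")
    case False
    then have "?p (coord j z) \<in> A"
      using inA by simp
    then have "f (?p (coord j z)) \<le> f z"
      using z dom_N3 by (intro mono point_axis_le) auto
    then have "coord i (f (?p (coord j z))) \<le> coord i (f z)"
      by (simp add: le_iff_coord)
    moreover have "coord j z - M \<le> coord i (f (?p (coord j z)))"
      using step[of "coord j z - M"] False by simp
    ultimately show ?thesis by simp
  qed simp
qed

text \<open>This is the antichain count. \<open>X\<close> is the preimage of the antichain of height \<open>k + t + 1\<close> in
  the slab where coordinate \<open>i\<close> is at most \<open>k\<close>. It covers that antichain up to the \<open>d\<close> points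
  missing from the range. Each \<open>z \<in> X\<close> fails to be above \<open>x\<close>, and the three coordinates in which it
  can fail give the three parts \<open>X1\<close>, \<open>X2\<close>, \<open>X3\<close>. An element of an antichain is determined by any
  two of its coordinates, so each part is bounded by counting the values of two coordinates; only
  for \<open>X1\<close> does the bound grow with \<open>t\<close>, and with slope \<open>k - 1\<close> instead of \<open>k\<close>.\<close>

lemma coord_image_le:
  assumes M: "\<And>j n. M < n \<Longrightarrow> point j n 1 1 \<in> A"
    and \<sigma>: "bij \<sigma>" "\<forall>i. \<forall>n>M. on_axis i (f (point (\<sigma> i) n 1 1))"
    and x: "x \<in> A"
  shows "coord i (f x) \<le> coord (\<sigma> i) x"
proof (rule ccontr)
  define k where "k = coord (\<sigma> i) x"
  define d where "d = card (N3 - f ` A)"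
  assume "\<not> ?thesis"
  then have k_less: "k < coord i (f x)"
    by (simp add: k_def)
  have "1 \<le> k"
    using x dom_N3 by (auto simp: k_def N3_iff_coord)
  then obtain k' where k': "k = Suc k'"
    by (cases k) auto
  obtain j' j'' where others: "UNIV = {\<sigma> i, j', j''}" "\<sigma> i \<noteq> j'" "\<sigma> i \<noteq> j''" "j' \<noteq> j''"
    by (cases "\<sigma> i") (auto simp: UNIV_axis)
  obtain i' where i': "j' = \<sigma> i'"
    using \<sigma>(1) by (metis bij_pointE)
  \<comment> \<open>\<open>E\<close> bounds the parts \<open>X2\<close> and \<open>X3\<close>; \<open>t\<close> is chosen so that \<open>k * t\<close> exceeds
    \<open>k' * (k + t + 1 + M) + E + d\<close>, the bound on the image and the missing points together.\<close>
  define E where "E = Suc (k + M) * coord j' x + Suc (k + M) * coord j'' x"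
  define t where "t = Suc (d + k' * (k + M + 2) + E)"
  define X where "X = {z \<in> A. coord i (f z) \<le> k \<and> height (f z) = k + t + 1}"
  have X_bound: "coord (\<sigma> i) z \<le> k + M" "coord j' z \<le> k + t + 1 + M" if "z \<in> X" for z
  proof -
    have "z \<in> A"
      using that by (simp add: X_def)
    then have "coord (\<sigma> l) z \<le> coord l (f z) + M" for l
      using coord_le_coord_image_plus[OF M] \<sigma>(2) by blast
    then have "coord (\<sigma> i) z \<le> coord i (f z) + M" "coord j' z \<le> coord i' (f z) + M"
      unfolding i' by simp_all
    moreover have "coord i (f z) \<le> k" "coord i' (f z) \<le> k + t + 1"
      using that coord_le_height[of i' "f z"] by (auto simp: X_def)
    ultimately show "coord (\<sigma> i) z \<le> k + M" "coord j' z \<le> k + t + 1 + M"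
      by simp_all
  qed
  have X_inj: "z = w"
    if "z \<in> X" "w \<in> X" "l \<noteq> l'" "coord l z = coord l w" "coord l' z = coord l' w" for z w l l'
  proof -
    have "z \<le> w \<or> w \<le> z"
      using that(3-5) unfolding le_iff_coord all_axis by (cases l; cases l'; simp; linarith)
    then show ?thesis
      using that by (intro comparable_same_height_eq) (auto simp: X_def)
  qed
  define X1 where "X1 = {z \<in> X. coord (\<sigma> i) z < k}"
  define X2 where "X2 = {z \<in> X. coord j' z < coord j' x}"
  define X3 where "X3 = {z \<in> X. coord j'' z < coord j'' x}"
  have "X \<subseteq> X1 \<union> X2 \<union> X3"
  proof
    fix z assume z: "z \<in> X"
    then have "\<not> f x \<le> f z"
      using k_less le_iff_coord[of "f x"] unfolding X_def by (metis (lifting) leD le_trans mem_Collect_eq)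
    then have "\<not> x \<le> z"
      using mono[OF x, of z] z unfolding X_def by blast
    then obtain l where "coord l z < coord l x"
      by (metis le_iff_coord not_le)
    moreover have "l = \<sigma> i \<or> l = j' \<or> l = j''"
      using others(1) by auto
    ultimately show "z \<in> X1 \<union> X2 \<union> X3"
      using z by (auto simp: X1_def X2_def X3_def k_def)
  qed
  moreover have "X1 \<subseteq> X" "X2 \<subseteq> X" "X3 \<subseteq> X"
    by (auto simp: X1_def X2_def X3_def)
  moreover have fin_X: "finite X"
  proof -
    have "f ` X \<subseteq> {y. height y \<le> k + t + 1}"
      by (auto simp: X_def)
    then have "finite (f ` X)"
      using finite_height_le finite_subset by blast
    moreover have "inj_on f X"
      using inj by (rule inj_on_subset) (auto simp: X_def)
    ultimately show ?thesis
      by (rule finite_imageD)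
  qed
  ultimately have "card X \<le> card (X1 \<union> X2 \<union> X3)"
    by (meson card_mono finite_UnI finite_subset)
  also have "\<dots> \<le> card X1 + card X2 + card X3"
    by (meson add_le_mono1 card_Un_le le_trans)
  also have "card X1 \<le> k' * (k + t + 1 + M)"
  proof -
    have "card X1 \<le> card ({1..k'} \<times> {1..k + t + 1 + M})"
    proof (rule card_inj_on_le)
      show "inj_on (\<lambda>z. (coord (\<sigma> i) z, coord j' z)) X1"
        using X_inj others(2) by (auto simp: inj_on_def X1_def)
      show "(\<lambda>z. (coord (\<sigma> i) z, coord j' z)) ` X1 \<subseteq> {1..k'} \<times> {1..k + t + 1 + M}"
        using X_bound dom_N3 k' by (fastforce simp: X1_def X_def N3_iff_coord)
    qed simp
    then show ?thesis by simp
  qed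
  also have "card X2 \<le> Suc (k + M) * coord j' x"
  proof -
    have "card X2 \<le> card ({..k + M} \<times> {..<coord j' x})"
    proof (rule card_inj_on_le)
      show "inj_on (\<lambda>z. (coord (\<sigma> i) z, coord j' z)) X2"
        using X_inj others(2) by (auto simp: inj_on_def X2_def)
    qed (use X_bound in \<open>auto simp: X2_def\<close>)
    then show ?thesis by simp
  qed
  also have "card X3 \<le> Suc (k + M) * coord j'' x"
  proof -
    have "card X3 \<le> card ({..k + M} \<times> {..<coord j'' x})"
    proof (rule card_inj_on_le)
      show "inj_on (\<lambda>z. (coord (\<sigma> i) z, coord j'' z)) X3"
        using X_inj others(3) by (auto simp: inj_on_def X3_def)
    qed (use X_bound in \<open>auto simp: X3_def\<close>)
    then show ?thesis by simp
  qed
  finally have upper: "card X \<le> k' * (k + t + 1 + M) + E"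
    by (simp add: E_def)
  have "k * t \<le> card {y \<in> N3. coord i y \<le> k \<and> height y = k + t + 1}"
    by (rule card_slab_antichain)
  also have "\<dots> \<le> card (f ` X \<union> (N3 - f ` A))"
    by (intro card_mono) (use fin_X cofinite_ran in \<open>auto simp: X_def\<close>)
  also have "\<dots> \<le> card X + d"
    unfolding d_def by (meson card_Un_le card_image_le[OF fin_X] add_le_mono1 le_trans)
  also have "\<dots> \<le> k' * (k + t + 1 + M) + E + d"
    using upper by simp
  finally show False
    by (simp add: t_def k' algebra_simps)
qed

theorem height_image_le:
  assumes "x \<in> A"
  shows "height (f x) \<le> height x"
proof -
  obtain M where M: "\<And>j n. M < n \<Longrightarrow> point j n 1 1 \<in> A"
    using axes_eventually_in_dom by blast
  obtain \<sigma> where \<sigma>: "bij \<sigma>" "\<forall>i. \<forall>n>M. on_axis i (f (point (\<sigma> i) n 1 1))"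
    using axis_permutation[OF M] by blast
  have "height (f x) \<le> (\<Sum>i\<in>UNIV. coord (\<sigma> i) x)"
    unfolding height_eq_sum by (intro sum_mono coord_image_le[OF M \<sigma> assms])
  also have "\<dots> = height x"
    unfolding height_eq_sum using sum.reindex_bij_betw[OF \<sigma>(1)] .
  finally show ?thesis .
qed

end

section \<open>Mutual monotone injections are isomorphisms\<close>

lemma mutual_inj_finite_surj:
  assumes "finite P" "finite Q" "inj_on g P" "g ` P \<subseteq> Q" "inj_on h Q" "h ` Q \<subseteq> P"
  shows "g ` P = Q"
  using assms by (metis card_image card_inj_on_le card_subset_eq le_antisym)

text \<open>The argument runs on the comparable pairs of bounded height: these form a finite set, and a
  pair in \<open>Q\<close> having a comparable preimage says exactly that \<open>g\<close> reflects the order. Surjectivity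
  is the case of a pair \<open>(v, v)\<close>.\<close>

lemma mutual_height_decreasing_iso:
  assumes g: "inj_on g P" "g ` P \<subseteq> Q" "\<And>x. x \<in> P \<Longrightarrow> height (g x) \<le> height x"
      "\<And>x y. \<lbrakk>x \<in> P; y \<in> P; x \<le> y\<rbrakk> \<Longrightarrow> g x \<le> g y"
    and h: "inj_on h Q" "h ` Q \<subseteq> P" "\<And>x. x \<in> Q \<Longrightarrow> height (h x) \<le> height x"
      "\<And>x y. \<lbrakk>x \<in> Q; y \<in> Q; x \<le> y\<rbrakk> \<Longrightarrow> h x \<le> h y"
  shows "g ` P = Q" and "\<lbrakk>x \<in> P; y \<in> P; g x \<le> g y\<rbrakk> \<Longrightarrow> x \<le> y"
proof -
  define R where "R B n = {(u, v). u \<in> B \<and> v \<in> B \<and> u \<le> v \<and> height u \<le> n \<and> height v \<le> n}" for B n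
  have fin: "finite (R B n)" for B n
    by (rule finite_subset[of _ "{x. height x \<le> n} \<times> {x. height x \<le> n}"])
      (auto simp: R_def finite_height_le)
  have img: "map_prod g g ` R P n = R Q n" for n
  proof (rule mutual_inj_finite_surj)
    show "inj_on (map_prod g g) (R P n)" "inj_on (map_prod h h) (R Q n)"
      using g(1) h(1) by (auto simp: inj_on_def R_def)
    show "map_prod g g ` R P n \<subseteq> R Q n"
      using g(2,4) le_trans[OF g(3)] by (auto simp: R_def)
    show "map_prod h h ` R Q n \<subseteq> R P n"
      using h(2,4) le_trans[OF h(3)] by (auto simp: R_def)
  qed (rule fin)+
  show "g ` P = Q"
  proof
    show "Q \<subseteq> g ` P"
    proof
      fix v assume "v \<in> Q"
      then have "(v, v) \<in> R Q (height v)"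
        by (simp add: R_def)
      then show "v \<in> g ` P"
        unfolding img[symmetric] by (auto simp: R_def)
    qed
  qed (rule g)
  show "x \<le> y" if "x \<in> P" "y \<in> P" "g x \<le> g y" for x y
  proof -
    have "(g x, g y) \<in> R Q (height (g x) + height (g y))"
      using that g(2) by (auto simp: R_def)
    then obtain x' y' where "x' \<in> P" "y' \<in> P" "x' \<le> y'" "g x = g x'" "g y = g y'"
      unfolding img[symmetric] by (auto simp: R_def)
    with that g(1) show ?thesis
      by (metis inj_onD)
  qed
qed

section \<open>The monoid of cofinite monotone partial injections\<close>

abbreviation app :: "('a \<rightharpoonup> 'a) \<Rightarrow> 'a \<Rightarrow> 'a" where
  "app \<alpha> x \<equiv> the (\<alpha> x)"

lemma pmult_eq_Some: "pmult \<alpha> \<beta> x = Some z \<longleftrightarrow> (\<exists>y. \<alpha> x = Some y \<and> \<beta> y = Some z)"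
  by (auto simp: pmult_def map_comp_def split: option.splits)

lemma PO_infty_inj: "\<alpha> \<in> PO_infty \<Longrightarrow> \<alpha> x = Some z \<Longrightarrow> \<alpha> y = Some z \<Longrightarrow> x = y"
  unfolding PO_infty_def inj_on_def by (metis (mono_tags, lifting) domI mem_Collect_eq)

lemma ran_eq_image: "ran \<alpha> = app \<alpha> ` dom \<alpha>"
  by (force simp: ran_def dom_def)

lemma PO_infty_cofinite_mono_inj:
  assumes "\<alpha> \<in> PO_infty"
  shows "cofinite_mono_inj (app \<alpha>) (dom \<alpha>)"
proof
  show "inj_on (app \<alpha>) (dom \<alpha>)"
    using PO_infty_inj[OF assms] by (fastforce simp: inj_on_def)
qed (use assms in \<open>auto simp: PO_infty_def ran_eq_image[symmetric] intro: ranI\<close>)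

lemma id_in_PO_infty: "Some |` N3 \<in> PO_infty"
proof -
  have "ran (Some |` N3) = N3"
    by (force simp: ran_def restrict_map_def)
  then show ?thesis
    by (simp add: PO_infty_def inj_on_def)
qed

lemma pmult_id_left:
  assumes "\<alpha> \<in> PO_infty"
  shows "pmult (Some |` N3) \<alpha> = \<alpha>"
proof
  fix x
  have "dom \<alpha> \<subseteq> N3"
    using assms by (simp add: PO_infty_def)
  then have "\<alpha> x = None" if "x \<notin> N3"
    using that by blast
  then show "pmult (Some |` N3) \<alpha> x = \<alpha> x"
    by (cases "x \<in> N3") (simp_all add: pmult_def map_comp_def)
qed

lemma pmult_id_right:
  assumes "\<alpha> \<in> PO_infty"
  shows "pmult \<alpha> (Some |` N3) = \<alpha>"
proof
  fix x
  have "ran \<alpha> \<subseteq> N3"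
    using assms by (simp add: PO_infty_def)
  then have "y \<in> N3" if "\<alpha> x = Some y" for y
    using ranI[of \<alpha>, OF that] by blast
  then show "pmult \<alpha> (Some |` N3) x = \<alpha> x"
    by (cases "\<alpha> x") (simp_all add: pmult_def map_comp_def)
qed

text \<open>The partial inverse of an element need not be monotone on its whole range, since the element
  may create new comparabilities; hence the restriction to a set \<open>P\<close> where it reflects the
  order.\<close>

lemma PO_infty_inverse_on:
  assumes \<gamma>: "\<gamma> \<in> PO_infty" and P: "P \<subseteq> dom \<gamma>" "finite (N3 - P)" "finite (N3 - app \<gamma> ` P)"
    and refl: "\<And>x y. \<lbrakk>x \<in> P; y \<in> P; app \<gamma> x \<le> app \<gamma> y\<rbrakk> \<Longrightarrow> x \<le> y"
  obtains \<kappa> where "\<kappa> \<in> PO_infty" "\<And>v u. \<kappa> v = Some u \<longleftrightarrow> u \<in> P \<and> \<gamma> u = Some v"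
proof -
  interpret cofinite_mono_inj "app \<gamma>" "dom \<gamma>"
    using \<gamma> by (rule PO_infty_cofinite_mono_inj)
  define \<kappa> where "\<kappa> v = (if v \<in> app \<gamma> ` P then Some (inv_into P (app \<gamma>) v) else None)" for v
  have injP: "inj_on (app \<gamma>) P"
    using inj P(1) by (rule inj_on_subset)
  have some: "\<kappa> v = Some u \<longleftrightarrow> u \<in> P \<and> \<gamma> u = Some v" for u v
  proof
    assume "\<kappa> v = Some u"
    then have v: "v \<in> app \<gamma> ` P" and u: "u = inv_into P (app \<gamma>) v"
      by (simp_all add: \<kappa>_def split: if_splits)
    have "u \<in> P" "app \<gamma> u = v"
      unfolding u using v by (rule inv_into_into, rule f_inv_into_f)
    then show "u \<in> P \<and> \<gamma> u = Some v"
      using P(1) by force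
  next
    assume "u \<in> P \<and> \<gamma> u = Some v"
    then have "u \<in> P" "v = app \<gamma> u"
      by simp_all
    then show "\<kappa> v = Some u"
      using inv_into_f_f[OF injP, of u] by (auto simp: \<kappa>_def)
  qed
  have dom: "dom \<kappa> = app \<gamma> ` P"
    by (rule set_eqI) (simp add: domIff \<kappa>_def del: not_None_eq)
  have ran: "ran \<kappa> = P"
    using P(1) by (auto simp: ran_def some)
  have "\<kappa> \<in> PO_infty"
    unfolding PO_infty_def
  proof (intro CollectI conjI ballI impI)
    show "dom \<kappa> \<subseteq> N3" "ran \<kappa> \<subseteq> N3"
      using P(1) dom_N3 ran_N3 unfolding dom ran by blast+
    show "inj_on \<kappa> (dom \<kappa>)"
      by (rule inj_onI) (metis some domD option.inject)
    show "the (\<kappa> u) \<le> the (\<kappa> v)" if "u \<in> dom \<kappa>" "v \<in> dom \<kappa>" "u \<le> v" for u v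
      using that refl some by (metis domD option.sel)
  qed (use P in \<open>simp_all add: dom ran\<close>)
  with some show ?thesis
    using that by blast
qed

section \<open>Green's relations\<close>

text \<open>The semigroup contains the identity map of the octant, which absorbs the one-sided cases of
  the definition of the principal ideal.\<close>

lemma mem_ideal1_iff:
  assumes "\<beta> \<in> PO_infty"
  shows "\<alpha> \<in> ideal1 PO_infty pmult \<beta> \<longleftrightarrow>
    (\<exists>\<gamma>\<in>PO_infty. \<exists>\<delta>\<in>PO_infty. \<alpha> = pmult (pmult \<gamma> \<beta>) \<delta>)"
  unfolding ideal1_def using id_in_PO_infty assms
    pmult_id_left[OF assms] pmult_id_right PO_infty_pmult_closed
  by simp metis

lemma ideal1_subset:
  assumes "\<beta> \<in> PO_infty" "\<alpha> \<in> ideal1 PO_infty pmult \<beta>"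
  shows "ideal1 PO_infty pmult \<alpha> \<subseteq> ideal1 PO_infty pmult \<beta>"
proof
  fix \<xi> assume \<xi>: "\<xi> \<in> ideal1 PO_infty pmult \<alpha>"
  obtain \<gamma> \<delta> where 1: "\<gamma> \<in> PO_infty" "\<delta> \<in> PO_infty" "\<alpha> = pmult (pmult \<gamma> \<beta>) \<delta>"
    using assms mem_ideal1_iff by blast
  then have "\<alpha> \<in> PO_infty"
    using assms(1) PO_infty_pmult_closed by simp
  then obtain \<gamma>' \<delta>' where 2: "\<gamma>' \<in> PO_infty" "\<delta>' \<in> PO_infty" "\<xi> = pmult (pmult \<gamma>' \<alpha>) \<delta>'"
    using \<xi> mem_ideal1_iff by blast
  have "\<xi> = pmult (pmult (pmult \<gamma>' \<gamma>) \<beta>) (pmult \<delta> \<delta>')"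
    using 1 2 assms(1) by (simp add: PO_infty.assoc PO_infty_pmult_closed)
  then show "\<xi> \<in> ideal1 PO_infty pmult \<beta>"
    using 1 2 assms(1) mem_ideal1_iff PO_infty_pmult_closed by blast
qed

lemma green_D_subset_green_J: "green_D PO_infty pmult \<subseteq> green_J PO_infty pmult"
proof -
  have L: "ideal1 PO_infty pmult \<alpha> \<subseteq> ideal1 PO_infty pmult \<beta>"
    if "(\<alpha>, \<beta>) \<in> green_L PO_infty pmult" for \<alpha> \<beta>
    using that by (intro ideal1_subset) (auto simp: PO_infty.green_L_iff ideal1_def)
  have R: "ideal1 PO_infty pmult \<alpha> \<subseteq> ideal1 PO_infty pmult \<beta>"
    if "(\<alpha>, \<beta>) \<in> green_R PO_infty pmult" for \<alpha> \<beta>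
    using that by (intro ideal1_subset) (auto simp: PO_infty.green_R_iff ideal1_def)
  have "(\<beta>, \<alpha>) \<in> green_L PO_infty pmult" if "(\<alpha>, \<beta>) \<in> green_L PO_infty pmult" for \<alpha> \<beta>
    using that by (auto simp: green_L_def)
  moreover have "(\<beta>, \<alpha>) \<in> green_R PO_infty pmult" if "(\<alpha>, \<beta>) \<in> green_R PO_infty pmult" for \<alpha> \<beta>
    using that by (auto simp: green_R_def)
  ultimately have eq: "ideal1 PO_infty pmult \<alpha> = ideal1 PO_infty pmult \<beta>"
    if "(\<alpha>, \<xi>) \<in> green_L PO_infty pmult" "(\<xi>, \<beta>) \<in> green_R PO_infty pmult" for \<alpha> \<beta> \<xi>
    using that L R by (meson subset_antisym subset_trans)
  show ?thesis
  proof (rule subrelI)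
    fix \<alpha> \<beta> assume "(\<alpha>, \<beta>) \<in> green_D PO_infty pmult"
    then obtain \<xi> where "(\<alpha>, \<xi>) \<in> green_L PO_infty pmult" "(\<xi>, \<beta>) \<in> green_R PO_infty pmult"
      unfolding green_D_def by blast
    then show "(\<alpha>, \<beta>) \<in> green_J PO_infty pmult"
      using eq[of \<alpha> \<xi> \<beta>] by (simp add: green_J_def green_L_def green_R_def)
  qed
qed

lemma PO_infty_mutual_iso:
  assumes \<gamma>: "\<gamma> \<in> PO_infty" "P \<subseteq> dom \<gamma>" "app \<gamma> ` P \<subseteq> Q"
    and \<gamma>': "\<gamma>' \<in> PO_infty" "Q \<subseteq> dom \<gamma>'" "app \<gamma>' ` Q \<subseteq> P"
  shows "app \<gamma> ` P = Q" and "\<And>x y. \<lbrakk>x \<in> P; y \<in> P; app \<gamma> x \<le> app \<gamma> y\<rbrakk> \<Longrightarrow> x \<le> y"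
proof -
  interpret g: cofinite_mono_inj "app \<gamma>" "dom \<gamma>"
    using \<gamma>(1) by (rule PO_infty_cofinite_mono_inj)
  interpret h: cofinite_mono_inj "app \<gamma>'" "dom \<gamma>'"
    using \<gamma>'(1) by (rule PO_infty_cofinite_mono_inj)
  note iso = mutual_height_decreasing_iso[of "app \<gamma>" P Q "app \<gamma>'",
      OF inj_on_subset[OF g.inj \<gamma>(2)] \<gamma>(3) g.height_image_le[OF subsetD[OF \<gamma>(2)]]
        g.mono[OF subsetD[OF \<gamma>(2)] subsetD[OF \<gamma>(2)]]
        inj_on_subset[OF h.inj \<gamma>'(2)] \<gamma>'(3) h.height_image_le[OF subsetD[OF \<gamma>'(2)]]
        h.mono[OF subsetD[OF \<gamma>'(2)] subsetD[OF \<gamma>'(2)]]]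
  show "app \<gamma> ` P = Q"
    by (rule iso(1))
  show "\<And>x y. \<lbrakk>x \<in> P; y \<in> P; app \<gamma> x \<le> app \<gamma> y\<rbrakk> \<Longrightarrow> x \<le> y"
    by (rule iso(2))
qed

text \<open>The left factor maps domains. Once it does so onto \<open>dom \<beta>\<close>, every value of \<open>\<beta>\<close> is taken at
  an image of a point of \<open>dom \<alpha>\<close>, and the right factor must be defined there.\<close>

lemma factorization_maps:
  assumes "\<alpha> = pmult (pmult \<gamma> \<beta>) \<delta>"
  shows "dom \<alpha> \<subseteq> dom \<gamma>" "app \<gamma> ` dom \<alpha> \<subseteq> dom \<beta>"
    and "app \<gamma> ` dom \<alpha> = dom \<beta> \<Longrightarrow> ran \<beta> \<subseteq> dom \<delta> \<and> app \<delta> ` ran \<beta> \<subseteq> ran \<alpha>"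
proof -
  have \<alpha>: "\<alpha> x = Some w \<longleftrightarrow> (\<exists>y z. \<gamma> x = Some y \<and> \<beta> y = Some z \<and> \<delta> z = Some w)" for x w
    unfolding assms pmult_eq_Some by blast
  show 1: "dom \<alpha> \<subseteq> dom \<gamma>" "app \<gamma> ` dom \<alpha> \<subseteq> dom \<beta>"
  proof -
    have "\<gamma> x \<noteq> None \<and> app \<gamma> x \<in> dom \<beta>" if "x \<in> dom \<alpha>" for x
    proof -
      obtain w where "\<alpha> x = Some w"
        using \<open>x \<in> dom \<alpha>\<close> by blast
      then obtain y z where "\<gamma> x = Some y" "\<beta> y = Some z"
        unfolding \<alpha> by blast
      then show ?thesis
        by (simp add: domI)
    qed
    then show "dom \<alpha> \<subseteq> dom \<gamma>" "app \<gamma> ` dom \<alpha> \<subseteq> dom \<beta>"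
      by blast+
  qed
  assume onto: "app \<gamma> ` dom \<alpha> = dom \<beta>"
  have "\<exists>w. \<delta> z = Some w \<and> w \<in> ran \<alpha>" if z: "z \<in> ran \<beta>" for z
  proof -
    obtain y where y: "\<beta> y = Some z"
      using z by (auto simp: ran_def)
    then have "y \<in> app \<gamma> ` dom \<alpha>"
      using onto by auto
    then obtain x w where "\<alpha> x = Some w" "y = app \<gamma> x"
      by auto
    with \<alpha> y show ?thesis
      by (metis option.sel ranI)
  qed
  then have "\<delta> z \<noteq> None \<and> app \<delta> z \<in> ran \<alpha>" if "z \<in> ran \<beta>" for z
    using that by (metis option.distinct(1) option.sel)
  then show "ran \<beta> \<subseteq> dom \<delta> \<and> app \<delta> ` ran \<beta> \<subseteq> ran \<alpha>"
    by blast
qed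

lemma green_J_subset_green_D: "green_J PO_infty pmult \<subseteq> green_D PO_infty pmult"
proof (rule subrelI)
  fix \<alpha> \<beta> assume "(\<alpha>, \<beta>) \<in> green_J PO_infty pmult"
  then have S: "\<alpha> \<in> PO_infty" "\<beta> \<in> PO_infty"
    and eq: "ideal1 PO_infty pmult \<alpha> = ideal1 PO_infty pmult \<beta>"
    by (auto simp: green_J_def)
  have "\<alpha> \<in> ideal1 PO_infty pmult \<beta>" "\<beta> \<in> ideal1 PO_infty pmult \<alpha>"
    using eq by (auto simp: ideal1_def)
  then obtain \<gamma> \<delta> \<gamma>' \<delta>' where
    g: "\<gamma> \<in> PO_infty" "\<delta> \<in> PO_infty" "\<alpha> = pmult (pmult \<gamma> \<beta>) \<delta>" and
    h: "\<gamma>' \<in> PO_infty" "\<delta>' \<in> PO_infty" "\<beta> = pmult (pmult \<gamma>' \<alpha>) \<delta>'"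
    using mem_ideal1_iff S by blast
  note fg = factorization_maps[OF g(3)] and fh = factorization_maps[OF h(3)]
  note iso\<gamma> = PO_infty_mutual_iso[OF g(1) fg(1,2) h(1) fh(1,2)]
  have "app \<gamma>' ` dom \<beta> = dom \<alpha>"
    by (rule PO_infty_mutual_iso[OF h(1) fh(1,2) g(1) fg(1,2)])
  then have d: "ran \<beta> \<subseteq> dom \<delta>" "app \<delta> ` ran \<beta> \<subseteq> ran \<alpha>"
    and d': "ran \<alpha> \<subseteq> dom \<delta>'" "app \<delta>' ` ran \<alpha> \<subseteq> ran \<beta>"
    using fg(3) fh(3) iso\<gamma>(1) by blast+
  note iso\<delta> = PO_infty_mutual_iso[OF g(2) d h(2) d']
  have fin: "finite (N3 - dom \<alpha>)" "finite (N3 - dom \<beta>)" "finite (N3 - ran \<alpha>)" "finite (N3 - ran \<beta>)"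
    using S by (simp_all add: PO_infty_def)
  obtain \<kappa> where \<kappa>: "\<kappa> \<in> PO_infty" "\<And>v u. \<kappa> v = Some u \<longleftrightarrow> u \<in> dom \<alpha> \<and> \<gamma> u = Some v"
    using PO_infty_inverse_on[OF g(1) fg(1) fin(1) _ iso\<gamma>(2)] fin(2)
    unfolding iso\<gamma>(1) by blast
  obtain \<mu> where \<mu>: "\<mu> \<in> PO_infty" "\<And>v u. \<mu> v = Some u \<longleftrightarrow> u \<in> ran \<beta> \<and> \<delta> u = Some v"
    using PO_infty_inverse_on[OF g(2) d(1) fin(4) _ iso\<delta>(2)] fin(3)
    unfolding iso\<delta>(1) by blast
  define \<xi> where "\<xi> = pmult \<gamma> \<beta>"
  have \<alpha>: "\<alpha> = pmult \<xi> \<delta>"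
    using g(3) by (simp add: \<xi>_def)
  have \<xi>: "\<xi> \<in> PO_infty"
    unfolding \<xi>_def using g(1) S(2) by (rule PO_infty_pmult_closed)
  have onto: "\<exists>x\<in>dom \<alpha>. \<gamma> x = Some y" if "y \<in> dom \<beta>" for y
    using that iso\<gamma>(1) fg(1) by (smt (verit) domD domIff image_iff option.sel subsetD)
  have "pmult \<kappa> \<xi> y = Some z \<longleftrightarrow> \<beta> y = Some z" for y z
    unfolding \<xi>_def pmult_eq_Some \<kappa>(2) using onto by (metis domI option.sel)
  then have "\<beta> = pmult \<kappa> \<xi>"
    by (metis ext not_Some_eq)
  then have L: "(\<xi>, \<beta>) \<in> green_L PO_infty pmult"
    unfolding PO_infty.green_L_iff using \<xi> S(2) \<xi>_def g(1) \<kappa>(1) by blast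
  have "pmult \<alpha> \<mu> x = Some z \<longleftrightarrow> \<xi> x = Some z" for x z
  proof
    assume "pmult \<alpha> \<mu> x = Some z"
    then obtain w where "\<alpha> x = Some w" "\<delta> z = Some w"
      by (auto simp: pmult_eq_Some \<mu>(2))
    then show "\<xi> x = Some z"
      using PO_infty_inj[OF g(2)] unfolding \<alpha> pmult_eq_Some by metis
  next
    assume z: "\<xi> x = Some z"
    then have "z \<in> ran \<beta>"
      unfolding \<xi>_def pmult_eq_Some by (auto simp: ran_def)
    moreover obtain w where "\<delta> z = Some w"
      using \<open>z \<in> ran \<beta>\<close> d(1) by blast
    ultimately show "pmult \<alpha> \<mu> x = Some z"
      using z unfolding \<alpha> pmult_eq_Some \<mu>(2) by blast
  qed
  then have "\<xi> = pmult \<alpha> \<mu>"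
    by (metis ext not_Some_eq)
  then have R: "(\<alpha>, \<xi>) \<in> green_R PO_infty pmult"
    unfolding PO_infty.green_R_iff using \<xi> S(1) g(2) \<alpha> \<mu>(1) by blast
  show "(\<alpha>, \<beta>) \<in> green_D PO_infty pmult"
    unfolding green_D_def PO_infty.green_L_R_commute using R L by blast
qed

theorem theorem3p11:
  shows "green_D PO_infty pmult = green_J PO_infty pmult"
  using green_D_subset_green_J green_J_subset_green_D by (rule subset_antisym)

end
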